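(* Consider the $[\![12,2,3]\!]$ holographic heptagon code on physical qubits $1_A,\dots,6_A,1_B,\dots,6_B$, with stabilizer generators $g_1,\dots,g_{10}$ and logical operators $\overline{X}_A,\overline{Z}_A,\overline{X}_B,\overline{Z}_B$ given in the context. Let $|\psi\rangle$ be any state in the code space and let $H_A=H_{1_A}H_{2_A}H_{3_A}H_{4_A}H_{5_A}H_{6_A}$ be the product of physical Hadamard gates on the six qubits of block $A$. If the stabilizer generators $g_5$ and $g_{10}$ are measured on the state $H_A|\psi\rangle$, then the two outcomes always have opposite signs. Moreover, applying after the measurement the correction $$C=X_{4_B}X_{5_B}X_{6_B}\ \text{ if } g_5=+1,\ g_{10}=-1,\qquad C=Z_{4_B}Z_{5_B}Z_{6_B}\ \text{ if } g_5=-1,\ g_{10}=+1,$$ returns the state to the code space, and the overall operation (physical Hadamards on block $A$, measurement of $g_5$ and $g_{10}$, correction $C$) implements on the code space, up to a global phase, the logical Hadamard gate on logical qubit $A$ (exchanging $\overline{X}_A$ and $\overline{Z}_A$ by conjugation) and the identity on logical qubit $B$.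
   Context: The code space is the joint $+1$ eigenspace in $(\mathbb{C}^2)^{\otimes 12}$ of the stabilizer generators $g_1=X_{1_A}X_{2_A}X_{4_A}X_{5_A}$, $g_2=X_{2_A}X_{3_A}X_{5_A}X_{6_A}$, $g_3=X_{1_B}X_{2_B}X_{4_B}X_{5_B}$, $g_4=X_{2_B}X_{3_B}X_{5_B}X_{6_B}$, $g_5=X_{4_A}X_{5_A}X_{6_A}X_{4_B}X_{5_B}X_{6_B}$, $g_6=Z_{1_A}Z_{2_A}Z_{4_A}Z_{5_A}$, $g_7=Z_{2_A}Z_{3_A}Z_{5_A}Z_{6_A}$, $g_8=Z_{1_B}Z_{2_B}Z_{4_B}Z_{5_B}$, $g_9=Z_{2_B}Z_{3_B}Z_{5_B}Z_{6_B}$, $g_{10}=Z_{4_A}Z_{5_A}Z_{6_A}Z_{4_B}Z_{5_B}Z_{6_B}$. The logical operators are $\overline{X}_A=X_{1_A}X_{2_A}X_{3_A}$, $\overline{Z}_A=Z_{1_A}Z_{2_A}Z_{3_A}$, $\overline{X}_B=X_{1_B}X_{2_B}X_{3_B}$, $\overline{Z}_B=Z_{1_B}Z_{2_B}Z_{3_B}$. Here $X_j,Z_j$ are the Pauli operators and $H_j$ the Hadamard gate on physical qubit $j$. Measuring a Pauli operator $g$ with outcome $\pm1$ means the projective measurement with projectors $(\mathbb{1}\pm g)/2$ (the operators $g_5$ and $g_{10}$ commute). *)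

theory Defs
  imports "HOL-Analysis.Analysis"
begin

(* The state space (C^2)^{(x) 'q} of a register whose qubits are the elements of the finite type
   'q: a vector assigns an amplitude to every computational basis label s :: 'q => bool, where
   False stands for |0> and True for |1>. *)

type_synonym 'q ket = "complex ^ ('q \<Rightarrow> bool)"
type_synonym 'q operator = "complex ^ ('q \<Rightarrow> bool) ^ ('q \<Rightarrow> bool)"

definition pauli_X :: "complex ^ bool ^ bool" where
  "pauli_X = (\<chi> a b. if a = b then 0 else 1)"

definition pauli_Z :: "complex ^ bool ^ bool" where
  "pauli_Z = (\<chi> a b. if a = b then (if a then -1 else 1) else 0)"

definition hadamard :: "complex ^ bool ^ bool" where
  "hadamard = (\<chi> a b. (if a \<and> b then -1 else 1) / complex_of_real (sqrt 2))"

(* The tensor product of U on factor j with the identity on all other factors. *)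
definition on_qubit :: "complex ^ bool ^ bool \<Rightarrow> 'q::finite \<Rightarrow> 'q operator" where
  "on_qubit U j = (\<chi> s t. if \<forall>k. k \<noteq> j \<longrightarrow> s k = t k then U $ s j $ t j else 0)"

abbreviation X :: "'q::finite \<Rightarrow> 'q operator" where "X \<equiv> on_qubit pauli_X"
abbreviation Z :: "'q::finite \<Rightarrow> 'q operator" where "Z \<equiv> on_qubit pauli_Z"
abbreviation H :: "'q::finite \<Rightarrow> 'q operator" where "H \<equiv> on_qubit hadamard"

datatype qubit = A1 | A2 | A3 | A4 | A5 | A6 | B1 | B2 | B3 | B4 | B5 | B6

lemma UNIV_qubit: "(UNIV :: qubit set) = {A1, A2, A3, A4, A5, A6, B1, B2, B3, B4, B5, B6}"
  using qubit.exhaust by blast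

instance qubit :: finite
  by standard (simp add: UNIV_qubit)

datatype logical_qubit = LA | LB

lemma UNIV_logical_qubit: "(UNIV :: logical_qubit set) = {LA, LB}"
  using logical_qubit.exhaust by blast

instance logical_qubit :: finite
  by standard (simp add: UNIV_logical_qubit)

definition g1 :: "qubit operator" where "g1 = X A1 ** X A2 ** X A4 ** X A5"
definition g2 :: "qubit operator" where "g2 = X A2 ** X A3 ** X A5 ** X A6"
definition g3 :: "qubit operator" where "g3 = X B1 ** X B2 ** X B4 ** X B5"
definition g4 :: "qubit operator" where "g4 = X B2 ** X B3 ** X B5 ** X B6"
definition g5 :: "qubit operator" where "g5 = X A4 ** X A5 ** X A6 ** X B4 ** X B5 ** X B6"
definition g6 :: "qubit operator" where "g6 = Z A1 ** Z A2 ** Z A4 ** Z A5"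
definition g7 :: "qubit operator" where "g7 = Z A2 ** Z A3 ** Z A5 ** Z A6"
definition g8 :: "qubit operator" where "g8 = Z B1 ** Z B2 ** Z B4 ** Z B5"
definition g9 :: "qubit operator" where "g9 = Z B2 ** Z B3 ** Z B5 ** Z B6"
definition g10 :: "qubit operator" where "g10 = Z A4 ** Z A5 ** Z A6 ** Z B4 ** Z B5 ** Z B6"

definition code_space :: "qubit ket set" where
  "code_space = {\<psi>. \<forall>g \<in> {g1, g2, g3, g4, g5, g6, g7, g8, g9, g10}. g *v \<psi> = \<psi>}"

definition logical_XA :: "qubit operator" where "logical_XA = X A1 ** X A2 ** X A3"
definition logical_ZA :: "qubit operator" where "logical_ZA = Z A1 ** Z A2 ** Z A3"
definition logical_XB :: "qubit operator" where "logical_XB = X B1 ** X B2 ** X B3"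
definition logical_ZB :: "qubit operator" where "logical_ZB = Z B1 ** Z B2 ** Z B3"

(* The identification of C^2 (x) C^2 with the code space that is fixed, up to a phase, by the
   choice of logical operators: a linear isometry onto the code space carrying the Pauli operators
   of the two abstract qubits to the logical operators. *)
definition is_encoding :: "complex ^ (logical_qubit \<Rightarrow> bool) ^ (qubit \<Rightarrow> bool) \<Rightarrow> bool" where
  "is_encoding V \<longleftrightarrow>
     (\<forall>\<phi>. norm (V *v \<phi>) = norm \<phi>) \<and>
     range ((*v) V) = code_space \<and>
     V ** X LA = logical_XA ** V \<and> V ** Z LA = logical_ZA ** V \<and>
     V ** X LB = logical_XB ** V \<and> V ** Z LB = logical_ZB ** V"

definition HA :: "qubit operator" where
  "HA = H A1 ** H A2 ** H A3 ** H A4 ** H A5 ** H A6"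

(* Projector of the outcome a (equal to 1 or -1) when the Pauli operator g is measured. *)
definition outcome_proj :: "real \<Rightarrow> qubit operator \<Rightarrow> qubit operator" where
  "outcome_proj a g = (1/2) *\<^sub>R (mat 1 + a *\<^sub>R g)"

(* Measurement of g5 and g10 with outcomes a and b, respectively. *)
definition syndrome_proj :: "real \<Rightarrow> real \<Rightarrow> qubit operator" where
  "syndrome_proj a b = outcome_proj b g10 ** outcome_proj a g5"

definition syndrome_prob :: "real \<Rightarrow> real \<Rightarrow> qubit ket \<Rightarrow> real" where
  "syndrome_prob a b \<psi> = (norm (syndrome_proj a b *v \<psi>))\<^sup>2"

definition post_state :: "real \<Rightarrow> real \<Rightarrow> qubit ket \<Rightarrow> qubit ket" where
  "post_state a b \<psi> =
     (1 / norm (syndrome_proj a b *v \<psi>)) *\<^sub>R (syndrome_proj a b *v \<psi>)"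

(* Only the two cases with opposite outcomes matter; otherwise no correction is applied. *)
definition correction :: "real \<Rightarrow> real \<Rightarrow> qubit operator" where
  "correction a b =
     (if a = 1 \<and> b = -1 then X B4 ** X B5 ** X B6
      else if a = -1 \<and> b = 1 then Z B4 ** Z B5 ** Z B6
      else mat 1)"

(* Final state of the whole procedure on input \<psi>, given the outcomes a of g5 and b of g10. *)
definition protocol :: "real \<Rightarrow> real \<Rightarrow> qubit ket \<Rightarrow> qubit ket" where
  "protocol a b \<psi> = correction a b *v post_state a b (HA *v \<psi>)"

end

(* Write X' and Z' for the products of the X's and of the Z's on qubits 4, 5, 6 of a block. For psi
   in the code space, conjugating g5 and g10 by HA turns them into Z'_A X'_B and X'_A Z'_B, whose
   product is - g5 g10; so H_A psi has g5 g10 = -1 and the outcomes are opposite. Measuring and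
   correcting gives (X'_A + X'_B) HA psi / sqrt 2 or (Z'_A + Z'_B) HA psi / sqrt 2, and both are
   equal to HA (X'_A + Z'_A) psi / sqrt 2. This is a linear isometry on the code space that
   conjugates the logical operators like a Hadamard gate on A, and by irreducibility of the logical
   Paulis it is the logical Hadamard gate up to one phase, independent of the outcomes. *)

theory Submission
  imports Defs
begin

section \<open>Single-qubit operators and the algebra of Paulis and Hadamards\<close>

lemma on_qubit_apply:
  "(on_qubit U j *v \<psi>) $ s =
    U $ s j $ False * \<psi> $ (s(j := False)) + U $ s j $ True * \<psi> $ (s(j := True))"
proof -
  have "(on_qubit U j *v \<psi>) $ s =
      (\<Sum>t\<in>UNIV. (if \<forall>k. k \<noteq> j \<longrightarrow> s k = t k then U $ s j $ t j else 0) * \<psi> $ t)"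
    by (simp add: on_qubit_def matrix_vector_mult_def)
  \<comment> \<open>Only labels agreeing with \<open>s\<close> off \<open>j\<close> contribute, and
    these are the two updates of \<open>s\<close> at \<open>j\<close>.\<close>
  also have "\<dots> = (\<Sum>t\<in>{s(j := False), s(j := True)}. U $ s j $ t j * \<psi> $ t)"
  proof (rule sum.mono_neutral_cong_right)
    show "\<forall>t\<in>UNIV - {s(j := False), s(j := True)}.
        (if \<forall>k. k \<noteq> j \<longrightarrow> s k = t k then U $ s j $ t j else 0) * \<psi> $ t = 0"
    proof
      fix t assume t: "t \<in> UNIV - {s(j := False), s(j := True)}"
      have "t = s(j := t j)" if "\<forall>k. k \<noteq> j \<longrightarrow> s k = t k"
        using that by (auto simp: fun_eq_iff)
      with t show "(if \<forall>k. k \<noteq> j \<longrightarrow> s k = t k then U $ s j $ t j else 0) * \<psi> $ t = 0"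
        by (cases "t j") auto
    qed
  qed auto
  also have "\<dots> = U $ s j $ False * \<psi> $ (s(j := False)) + U $ s j $ True * \<psi> $ (s(j := True))"
  proof -
    have "s(j := False) \<noteq> s(j := True)" by (metis fun_upd_same)
    then show ?thesis by simp
  qed
  finally show ?thesis .
qed

lemma on_qubit_commute:
  assumes "i \<noteq> j"
  shows "on_qubit U i *v (on_qubit W j *v \<psi>) = on_qubit W j *v (on_qubit U i *v \<psi>)"
  using assms
  by (auto simp: vec_eq_iff on_qubit_apply fun_upd_twist algebra_simps)

lemma on_qubit_mult:
  "on_qubit U i *v (on_qubit W i *v \<psi>) = on_qubit (U ** W) i *v \<psi>"
  by (simp add: vec_eq_iff on_qubit_apply matrix_matrix_mult_def UNIV_bool algebra_simps)

lemma on_qubit_one [simp]: "on_qubit (mat 1) i *v \<psi> = \<psi>"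
proof -
  have "(on_qubit (mat 1) i *v \<psi>) $ s = \<psi> $ s" for s
    using fun_upd_triv[of s i] by (cases "s i") (simp_all add: on_qubit_apply mat_def)
  then show ?thesis by (simp add: vec_eq_iff)
qed

lemma on_qubit_uminus: "on_qubit (- U) i *v \<psi> = - (on_qubit U i *v \<psi>)"
  by (simp add: vec_eq_iff on_qubit_apply)

lemma X_apply: "(X j *v \<psi>) $ s = \<psi> $ (s(j := \<not> s j))"
  by (cases "s j") (simp_all add: on_qubit_apply pauli_X_def)

lemma Z_apply: "(Z j *v \<psi>) $ s = (if s j then - \<psi> $ s else \<psi> $ s)"
  using fun_upd_triv[of s j] by (cases "s j") (simp_all add: on_qubit_apply pauli_Z_def)

text \<open>The 2 by 2 identities behind all operator relations; \<open>on_qubit_mult\<close>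
  carries them over to any register.\<close>

lemma pauli_hadamard_products:
  "pauli_X ** pauli_X = mat 1" "pauli_Z ** pauli_Z = mat 1"
  "pauli_Z ** pauli_X = - (pauli_X ** pauli_Z)"
  "hadamard ** hadamard = mat 1"
  "hadamard ** pauli_X = pauli_Z ** hadamard" "hadamard ** pauli_Z = pauli_X ** hadamard"
  by (simp_all add: vec_eq_iff matrix_matrix_mult_def pauli_X_def pauli_Z_def hadamard_def mat_def
        UNIV_bool all_bool_eq field_simps flip: of_real_mult)

lemma X_X: "X i *v (X i *v \<psi>) = \<psi>"
  and Z_Z: "Z i *v (Z i *v \<psi>) = \<psi>"
  and H_H: "H i *v (H i *v \<psi>) = \<psi>"
  and Z_X: "Z i *v (X i *v \<psi>) = - (X i *v (Z i *v \<psi>))"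
  and H_X: "H i *v (X i *v \<psi>) = Z i *v (H i *v \<psi>)"
  and H_Z: "H i *v (Z i *v \<psi>) = X i *v (H i *v \<psi>)"
  by (simp_all only: on_qubit_mult pauli_hadamard_products on_qubit_uminus on_qubit_one)

text \<open>For \<open>i = j\<close> both sides coincide, so no side condition remains. As
  permutative rewrite rules these sort the factors of a product, which lets repeated Pauli factors
  meet and cancel.\<close>

lemma X_left_commute: "X i *v (X j *v \<psi>) = X j *v (X i *v \<psi>)"
  and Z_left_commute: "Z i *v (Z j *v \<psi>) = Z j *v (Z i *v \<psi>)"
  and H_left_commute: "H i *v (H j *v \<psi>) = H j *v (H i *v \<psi>)"
  by (cases "i = j", simp, erule on_qubit_commute)+

lemma matrix_vector_mult_uminus: "A *v (- v) = - (A *v (v :: complex ^ 'n))"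
  using matrix_vector_mult_diff_distrib[of A 0 v] by simp

lemma complex_matrix_vector_mult_scaleR: "A *v (c *\<^sub>R v) = c *\<^sub>R (A *v (v :: complex ^ 'n))"
  by (simp add: vec_eq_iff matrix_vector_mult_def scaleR_sum_right)

lemma scaleR_matrix_vector_mult: "(c *\<^sub>R A) *v v = c *\<^sub>R (A *v (v :: complex ^ 'n))"
  by (simp add: vec_eq_iff matrix_vector_mult_def scaleR_sum_right)

text \<open>These rules normalise any product of Paulis and Hadamards to the form
  Paulis X, then Paulis Z, then Hadamards, up to a sign.\<close>

lemmas pauli_normalize =
  X_X Z_Z Z_X H_X H_Z X_left_commute Z_left_commute H_left_commute
  on_qubit_commute[of _ _ pauli_Z pauli_X]
  on_qubit_commute[of _ _ hadamard pauli_X] on_qubit_commute[of _ _ hadamard pauli_Z]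
  matrix_vector_mult_uminus matrix_vector_right_distrib matrix_vector_mult_diff_distrib

lemmas stabilizer_defs = g1_def g2_def g3_def g4_def g5_def g6_def g7_def g8_def g9_def g10_def
lemmas logical_defs = logical_XA_def logical_ZA_def logical_XB_def logical_ZB_def
lemmas mult_action = matrix_vector_mul_assoc[symmetric]

section \<open>Norm preservation\<close>

lemma parallelogram_law:
  fixes v w :: "'a::real_inner"
  shows "(norm (v + w))\<^sup>2 + (norm (v - w))\<^sup>2 = 2 * (norm v)\<^sup>2 + 2 * (norm w)\<^sup>2"
  by (simp add: power2_norm_eq_inner inner_add inner_diff inner_commute)

text \<open>Self-adjointness moves one \<open>A\<close> across the inner product of
  \<open>A *v v\<close> with itself, where it cancels the other.\<close>

lemma norm_hermitian_involution:
  fixes A :: "complex ^ 'n ^ 'n"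
  assumes herm: "\<And>i j. A $ i $ j = cnj (A $ j $ i)" and inv: "\<And>v. A *v (A *v v) = v"
  shows "norm (A *v v) = norm v"
proof -
  \<comment> \<open>The real inner product on complex vectors is the real part of the Hermitian one,
    so self-adjointness can be checked with conjugates.\<close>
  have inner_Re: "inner x y = Re (x * cnj y)" for x y :: complex
    by (simp add: inner_complex_def)
  have adj: "inner (A *v v) w = inner v (A *v w)" for v w
  proof -
    have "inner (A *v v) w = (\<Sum>i\<in>UNIV. \<Sum>j\<in>UNIV. Re (A $ i $ j * v $ j * cnj (w $ i)))"
      by (simp add: inner_vec_def matrix_vector_mult_def inner_Re sum_distrib_right del: times_complex.sel)
    also have "\<dots> = (\<Sum>j\<in>UNIV. \<Sum>i\<in>UNIV. Re (A $ i $ j * v $ j * cnj (w $ i)))"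
      by (rule sum.swap)
    also have "\<dots> = (\<Sum>j\<in>UNIV. \<Sum>i\<in>UNIV. Re (v $ j * cnj (A $ j $ i * w $ i)))"
      by (subst herm) (simp add: mult_ac)
    also have "\<dots> = inner v (A *v w)"
      by (simp add: inner_vec_def matrix_vector_mult_def inner_Re sum_distrib_left del: times_complex.sel)
    finally show ?thesis .
  qed
  show ?thesis
    by (simp add: norm_eq_sqrt_inner adj inv)
qed

lemma on_qubit_hermitian:
  assumes "\<And>a b. U $ a $ b = cnj (U $ b $ a)"
  shows "on_qubit U i $ s $ t = cnj (on_qubit U i $ t $ s)"
  using assms[of "s i" "t i"] by (auto simp: on_qubit_def)

lemma norm_X [simp]: "norm (X i *v \<psi>) = norm \<psi>"
  by (rule norm_hermitian_involution[OF on_qubit_hermitian]) (simp_all add: X_X, simp add: pauli_X_def)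

lemma norm_Z [simp]: "norm (Z i *v \<psi>) = norm \<psi>"
  by (rule norm_hermitian_involution[OF on_qubit_hermitian]) (simp_all add: Z_Z, simp add: pauli_Z_def)

lemma norm_H [simp]: "norm (H i *v \<psi>) = norm \<psi>"
  by (rule norm_hermitian_involution[OF on_qubit_hermitian]) (simp_all add: H_H, simp add: hadamard_def)

lemma norm_HA [simp]: "norm (HA *v \<psi>) = norm \<psi>"
  by (simp add: HA_def mult_action)

section \<open>Measurement of \<open>g5\<close> and \<open>g10\<close>, and the correction\<close>

definition X456A :: "qubit operator" where "X456A = X A4 ** X A5 ** X A6"
definition Z456A :: "qubit operator" where "Z456A = Z A4 ** Z A5 ** Z A6"
definition X456B :: "qubit operator" where "X456B = X B4 ** X B5 ** X B6"
definition Z456B :: "qubit operator" where "Z456B = Z B4 ** Z B5 ** Z B6"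

lemmas half_defs = X456A_def Z456A_def X456B_def Z456B_def

text \<open>\<open>g5\<close> is the product of the commuting involutions \<open>X456A\<close> and
  \<open>X456B\<close>, so on a vector fixed by it both act alike.\<close>

lemma code_half_X: assumes "\<psi> \<in> code_space" shows "X456B *v \<psi> = X456A *v \<psi>"
proof -
  have "g5 *v \<psi> = \<psi>" using assms by (simp add: code_space_def)
  then have "X456A *v (g5 *v \<psi>) = X456A *v \<psi>" by simp
  moreover have "X456A *v (g5 *v \<psi>) = X456B *v \<psi>"
    by (simp add: half_defs g5_def mult_action pauli_normalize)
  ultimately show ?thesis by simp
qed

lemma code_half_Z: assumes "\<psi> \<in> code_space" shows "Z456B *v \<psi> = Z456A *v \<psi>"
proof -
  have "g10 *v \<psi> = \<psi>" using assms by (simp add: code_space_def)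
  then have "Z456A *v (g10 *v \<psi>) = Z456A *v \<psi>" by simp
  moreover have "Z456A *v (g10 *v \<psi>) = Z456B *v \<psi>"
    by (simp add: half_defs g10_def mult_action pauli_normalize)
  ultimately show ?thesis by simp
qed

text \<open>The common result of both outcomes in closed form: linear in \<open>\<psi>\<close>,
  since a constant replaces the state-dependent normalisation of \<open>post_state\<close>, and
  built from operators on block A only.\<close>

definition code_hadamard :: "qubit ket \<Rightarrow> qubit ket" where
  "code_hadamard \<psi> = (1 / sqrt 2) *\<^sub>R (HA *v (X456A *v \<psi> + Z456A *v \<psi>))"

text \<open>\<open>HA\<close> turns the block A half of \<open>g5\<close> from X to Z type; the half
  on B is then moved to A by the code condition.\<close>

lemma g5_HA: assumes "\<psi> \<in> code_space"
  shows "g5 *v (HA *v \<psi>) = HA *v (Z456A *v (X456A *v \<psi>))"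
proof -
  have "g5 *v (HA *v \<psi>) = HA *v (Z456A *v (X456B *v \<psi>))"
    by (simp add: HA_def half_defs g5_def mult_action pauli_normalize)
  then show ?thesis by (simp add: code_half_X[OF assms])
qed

text \<open>The sign arises because \<open>X456A\<close> and \<open>Z456A\<close> overlap in three
  qubits, an odd number, and hence anticommute.\<close>

lemma g10_HA: assumes "\<psi> \<in> code_space"
  shows "g10 *v (HA *v \<psi>) = - (g5 *v (HA *v \<psi>))"
proof -
  have "g10 *v (HA *v \<psi>) = HA *v (X456A *v (Z456B *v \<psi>))"
    by (simp add: HA_def half_defs g10_def mult_action pauli_normalize)
  also have "\<dots> = HA *v (X456A *v (Z456A *v \<psi>))" by (simp add: code_half_Z[OF assms])
  also have "\<dots> = - (HA *v (Z456A *v (X456A *v \<psi>)))"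
    by (simp add: HA_def half_defs mult_action pauli_normalize)
  finally show ?thesis by (simp add: g5_HA[OF assms])
qed

lemma g10_g10: "g10 *v (g10 *v \<psi>) = \<psi>"
  by (simp add: g10_def mult_action pauli_normalize)

lemma outcome_proj_apply: "outcome_proj a g *v \<psi> = (1/2) *\<^sub>R (\<psi> + a *\<^sub>R (g *v \<psi>))"
  by (simp add: outcome_proj_def matrix_vector_mult_add_rdistrib scaleR_matrix_vector_mult)

text \<open>On this vector \<open>g10\<close> acts as \<open>- g5\<close> and the product of the two
  as -1, which collapses the expanded projectors. Both coefficients vanish when \<open>a\<close> and
  \<open>b\<close> are both 1 or both -1.\<close>

lemma syndrome_proj_HA: assumes "\<psi> \<in> code_space"
  shows "syndrome_proj a b *v (HA *v \<psi>) =
    (1/4) *\<^sub>R ((1 - a * b) *\<^sub>R (HA *v \<psi>) + (a - b) *\<^sub>R (g5 *v (HA *v \<psi>)))"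
proof -
  have "g10 *v (g5 *v (HA *v \<psi>)) = - (HA *v \<psi>)"
    using g10_g10[of "HA *v \<psi>"] unfolding g10_HA[OF assms]
    by (simp add: matrix_vector_mult_uminus minus_equation_iff)
  then show ?thesis
    by (simp add: syndrome_proj_def mult_action outcome_proj_apply matrix_vector_right_distrib
        complex_matrix_vector_mult_scaleR g10_HA[OF assms] algebra_simps)
qed

text \<open>Makes the two opposite-sign outcomes equally likely, so \<open>post_state\<close>
  divides by the same number for every unit code state.\<close>

lemma norm_g5_measured: assumes "\<psi> \<in> code_space" "norm \<psi> = 1" "a \<in> {1, -1}"
  shows "norm (HA *v \<psi> + a *\<^sub>R (g5 *v (HA *v \<psi>))) = sqrt 2"
proof -
  let ?v = "HA *v \<psi>" and ?w = "g5 *v (HA *v \<psi>)"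
  have nw: "norm ?w = 1" using assms(2) by (simp add: g5_def mult_action)
  \<comment> \<open>The conjugate of g5 by HA stabilises the state and anticommutes with g5, so it exchanges
      the two outcomes of g5 without changing the norm.\<close>
  let ?T = "\<lambda>v. Z456A *v (X456B *v v)"
  have Tv: "?T ?v = ?v"
  proof -
    have "?T ?v = HA *v (g5 *v \<psi>)"
      by (simp add: HA_def half_defs g5_def mult_action pauli_normalize)
    then show ?thesis using assms(1) by (simp add: code_space_def)
  qed
  \<comment> \<open>The factor \<open>Z456A\<close> of \<open>?T\<close> meets the X half of
    \<open>g5\<close> in three qubits, whence the sign.\<close>
  have Tw: "?T ?w = - ?w"
  proof -
    have "?T (g5 *v ?v) = - (g5 *v (?T ?v))"
      by (simp add: half_defs g5_def mult_action pauli_normalize)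
    then show ?thesis by (simp add: Tv)
  qed
  have nT: "norm (?T v) = norm v" for v by (simp add: half_defs mult_action)
  have eq: "norm (?v + ?w) = norm (?v - ?w)"
    using nT[of "?v + ?w"] Tv Tw by (simp add: matrix_vector_right_distrib)
  have "(norm (?v + ?w))\<^sup>2 + (norm (?v - ?w))\<^sup>2 = 2 * (norm ?v)\<^sup>2 + 2 * (norm ?w)\<^sup>2"
    by (rule parallelogram_law)
  then have "(norm (?v + ?w))\<^sup>2 = 2" using assms(2) nw eq by simp
  then have "norm (?v + ?w) = sqrt 2" by (metis norm_ge_zero real_sqrt_unique)
  then show ?thesis using eq assms(3) by auto
qed

lemma protocol_eq_code_hadamard:
  assumes "\<psi> \<in> code_space" "norm \<psi> = 1" "(a, b) \<in> {(1, -1), (-1, 1)}"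
  shows "protocol a b \<psi> = code_hadamard \<psi>"
proof -
  let ?v = "HA *v \<psi>" and ?w = "g5 *v (HA *v \<psi>)"
  have a: "a \<in> {1, -1}" and b: "b = - a" using assms(3) by auto
  \<comment> \<open>With \<open>b = - a\<close> and \<open>a * a = 1\<close> the coefficients in
    \<open>syndrome_proj_HA\<close> are 2 and \<open>2 * a\<close>.\<close>
  have proj: "syndrome_proj a b *v ?v = (1/2) *\<^sub>R (?v + a *\<^sub>R ?w)"
    using a b by (auto simp: syndrome_proj_HA[OF assms(1)] scaleR_add_right scaleR_diff_right)
  have post: "post_state a b ?v = (1 / sqrt 2) *\<^sub>R (?v + a *\<^sub>R ?w)"
    unfolding post_state_def proj using norm_g5_measured[OF assms(1,2) a] by simp
  have corr: "correction a b *v (?v + a *\<^sub>R ?w) = HA *v (X456A *v \<psi> + Z456A *v \<psi>)"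
  proof (cases "a = 1")
    case True
    \<comment> \<open>\<open>X456B\<close> cancels its own half of \<open>g5\<close> and leaves
      \<open>X456A\<close>, which becomes \<open>Z456A\<close> when moved through
      \<open>HA\<close>.\<close>
    have "X456B *v (?v + ?w) = HA *v (X456B *v \<psi>) + HA *v (Z456A *v \<psi>)"
      by (simp add: HA_def half_defs g5_def mult_action pauli_normalize)
    then show ?thesis using True b
      by (simp add: correction_def X456B_def[symmetric] code_half_X[OF assms(1)]
          matrix_vector_right_distrib)
  next
    case False
    then have a: "a = -1" using a by auto
    \<comment> \<open>By \<open>g10_HA\<close> the vector \<open>?v - ?w\<close> is
      \<open>?v + g10 *v ?v\<close>, which gives the first case with X and Z exchanged.\<close>
    have "Z456B *v (?v + g10 *v ?v) = HA *v (Z456B *v \<psi>) + HA *v (X456A *v \<psi>)"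
      by (simp add: HA_def half_defs g10_def mult_action pauli_normalize)
    then show ?thesis using a b g10_HA[OF assms(1)]
      by (simp add: correction_def Z456B_def[symmetric] code_half_Z[OF assms(1)]
          matrix_vector_right_distrib)
  qed
  show ?thesis
    by (simp add: protocol_def post complex_matrix_vector_mult_scaleR corr code_hadamard_def)
qed

section \<open>The encoded Hadamard on the code space\<close>

lemma norm_code_hadamard:
  assumes "\<psi> \<in> code_space" "norm \<psi> = 1"
  shows "norm (code_hadamard \<psi>) = 1"
proof -
  have "norm (HA *v \<psi> + g5 *v (HA *v \<psi>)) = sqrt 2"
    using norm_g5_measured[OF assms, of 1] by simp
  \<comment> \<open>The norm is read off from the outcome \<open>g5 = 1\<close>, whose correction
    preserves norms.\<close>
  moreover have "X456B *v (HA *v \<psi> + g5 *v (HA *v \<psi>)) = HA *v (X456B *v \<psi>) + HA *v (Z456A *v \<psi>)"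
    by (simp add: HA_def half_defs g5_def mult_action pauli_normalize)
  moreover have "norm (X456B *v v) = norm v" for v by (simp add: X456B_def mult_action)
  ultimately show ?thesis
    by (metis (no_types, lifting) code_hadamard_def code_half_X[OF assms(1)] matrix_vector_right_distrib
        norm_scaleR real_sqrt_gt_zero zero_less_numeral abs_of_pos zero_less_divide_1_iff
        nonzero_eq_divide_eq less_irrefl)
qed

text \<open>The logical operators avoid qubits 4, 5, 6 of block A and so commute with
  \<open>X456A\<close> and \<open>Z456A\<close>; only \<open>HA\<close> changes their type, and only
  on block A.\<close>

lemma code_hadamard_logical:
  "code_hadamard (logical_XA *v \<psi>) = logical_ZA *v code_hadamard \<psi>"
  "code_hadamard (logical_ZA *v \<psi>) = logical_XA *v code_hadamard \<psi>"
  "code_hadamard (logical_XB *v \<psi>) = logical_XB *v code_hadamard \<psi>"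
  "code_hadamard (logical_ZB *v \<psi>) = logical_ZB *v code_hadamard \<psi>"
  by (simp_all add: code_hadamard_def logical_defs HA_def half_defs mult_action
      complex_matrix_vector_mult_scaleR pauli_normalize)

text \<open>Generators of block A meet qubits 4, 5, 6 in two places and so commute with
  \<open>X456A\<close> and \<open>Z456A\<close>, while \<open>HA\<close> switches their type; those
  of block B pass through. \<open>g5\<close> and \<open>g10\<close> are treated separately, by the
  code condition.\<close>

lemma code_hadamard_stabilizer:
  "g1 *v code_hadamard \<psi> = code_hadamard (g6 *v \<psi>)"
  "g2 *v code_hadamard \<psi> = code_hadamard (g7 *v \<psi>)"
  "g3 *v code_hadamard \<psi> = code_hadamard (g3 *v \<psi>)"
  "g4 *v code_hadamard \<psi> = code_hadamard (g4 *v \<psi>)"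
  "g6 *v code_hadamard \<psi> = code_hadamard (g1 *v \<psi>)"
  "g7 *v code_hadamard \<psi> = code_hadamard (g2 *v \<psi>)"
  "g8 *v code_hadamard \<psi> = code_hadamard (g8 *v \<psi>)"
  "g9 *v code_hadamard \<psi> = code_hadamard (g9 *v \<psi>)"
  by (simp_all add: code_hadamard_def stabilizer_defs HA_def half_defs mult_action
      complex_matrix_vector_mult_scaleR pauli_normalize)

lemma code_hadamard_in_code_space:
  assumes "\<psi> \<in> code_space"
  shows "code_hadamard \<psi> \<in> code_space"
proof -
  have "g5 *v code_hadamard \<psi> = code_hadamard \<psi>"
  proof -
    \<comment> \<open>Moved through \<open>HA\<close>, \<open>g5\<close> becomes
      \<open>Z456A\<close> times \<open>X456B\<close>, which on code states exchanges the two
      summands of \<open>code_hadamard\<close>. The same happens for \<open>g10\<close>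
      below.\<close>
    have "g5 *v code_hadamard \<psi> =
        (1 / sqrt 2) *\<^sub>R (HA *v (Z456A *v (X456A *v (X456B *v \<psi>)) + X456B *v \<psi>))"
      by (simp add: code_hadamard_def g5_def HA_def half_defs mult_action
          complex_matrix_vector_mult_scaleR pauli_normalize)
    moreover have "X456A *v (X456A *v \<psi>) = \<psi>"
      by (simp add: X456A_def mult_action pauli_normalize)
    ultimately show ?thesis by (simp add: code_half_X[OF assms] code_hadamard_def add.commute)
  qed
  moreover have "g10 *v code_hadamard \<psi> = code_hadamard \<psi>"
  proof -
    have "g10 *v code_hadamard \<psi> =
        (1 / sqrt 2) *\<^sub>R (HA *v (Z456B *v \<psi> + X456A *v (Z456A *v (Z456B *v \<psi>))))"
      by (simp add: code_hadamard_def g10_def HA_def half_defs mult_action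
          complex_matrix_vector_mult_scaleR pauli_normalize)
    moreover have "Z456A *v (Z456A *v \<psi>) = \<psi>"
      by (simp add: Z456A_def mult_action pauli_normalize)
    ultimately show ?thesis by (simp add: code_half_Z[OF assms] code_hadamard_def add.commute)
  qed
  ultimately show ?thesis
    using assms by (simp add: code_space_def code_hadamard_stabilizer)
qed

text \<open>A logical operator and a generator of the opposite type share zero or two qubits, so the
  signs cancel.\<close>

lemma logical_stabilizer:
  assumes "g \<in> {g1, g2, g3, g4, g5, g6, g7, g8, g9, g10}"
    and "L \<in> {logical_XA, logical_ZA, logical_XB, logical_ZB}"
  shows "g *v (L *v \<psi>) = L *v (g *v \<psi>)"
  using assms
  by (auto simp: stabilizer_defs logical_defs mult_action pauli_normalize)

lemma logical_in_code_space:
  assumes "\<psi> \<in> code_space" "L \<in> {logical_XA, logical_ZA, logical_XB, logical_ZB}"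
  shows "L *v \<psi> \<in> code_space"
proof -
  have "g *v (L *v \<psi>) = L *v \<psi>" if "g \<in> {g1, g2, g3, g4, g5, g6, g7, g8, g9, g10}" for g
    using logical_stabilizer[OF that assms(2), of \<psi>] assms(1) that by (auto simp: code_space_def)
  then show ?thesis unfolding code_space_def by blast
qed

lemma norm_logical:
  assumes "L \<in> {logical_XA, logical_ZA, logical_XB, logical_ZB}"
  shows "norm (L *v \<psi>) = norm \<psi>"
  using assms by (auto simp: logical_defs mult_action)

section \<open>An explicit encoding\<close>

definition Z_checks :: "(qubit \<Rightarrow> bool) \<Rightarrow> bool" where
  "Z_checks s \<longleftrightarrow>
     (s A1 \<noteq> s A2) = (s A4 \<noteq> s A5) \<and> (s A2 \<noteq> s A3) = (s A5 \<noteq> s A6) \<and>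
     (s B1 \<noteq> s B2) = (s B4 \<noteq> s B5) \<and> (s B2 \<noteq> s B3) = (s B5 \<noteq> s B6) \<and>
     ((s A4 \<noteq> s A5) \<noteq> s A6) = ((s B4 \<noteq> s B5) \<noteq> s B6)"

text \<open>Iterated (in)equality of booleans is an abelian group; this is its normal form.\<close>

lemma parity_normalize:
  "(P = (\<not> Q)) = (\<not> (P = Q))" "((\<not> P) = Q) = (\<not> (P = Q))" "(\<not> \<not> P) = P"
  "((P = Q) = R) = (P = (Q = R))" "(P = (Q = R)) = (Q = (P = R))" "(P = Q) = (Q = P)"
  "(P = (P = Q)) = Q" "(P = P) = True" "(P = True) = P" "(True = P) = P"
  "(P = False) = (\<not> P)" "(False = P) = (\<not> P)" "(\<not> True) = False" "(\<not> False) = True"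
  by blast+

text \<open>The checks are linear equations over the field with two elements. Substituting the first
  four into the last leaves qubits 1, 2, 3 of both blocks and \<open>A5\<close> free.\<close>

lemma Z_checks_solved:
  "Z_checks s \<longleftrightarrow> s A4 = ((s A1 \<noteq> s A2) \<noteq> s A5) \<and> s A6 = ((s A2 \<noteq> s A3) \<noteq> s A5) \<and>
   s B4 = ((s B1 \<noteq> s B2) \<noteq> s B5) \<and> s B6 = ((s B2 \<noteq> s B3) \<noteq> s B5) \<and>
   s B5 = (((s A1 \<noteq> s A3) \<noteq> s A5) \<noteq> (s B1 \<noteq> s B3))"
proof -
  have e:
    "((s A1 \<noteq> s A2) = (s A4 \<noteq> s A5)) = (s A4 = ((s A1 \<noteq> s A2) \<noteq> s A5))"
    "((s A2 \<noteq> s A3) = (s A5 \<noteq> s A6)) = (s A6 = ((s A2 \<noteq> s A3) \<noteq> s A5))"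
    "((s B1 \<noteq> s B2) = (s B4 \<noteq> s B5)) = (s B4 = ((s B1 \<noteq> s B2) \<noteq> s B5))"
    "((s B2 \<noteq> s B3) = (s B5 \<noteq> s B6)) = (s B6 = ((s B2 \<noteq> s B3) \<noteq> s B5))"
    by (simp_all only: parity_normalize)
  have "(((s A4 \<noteq> s A5) \<noteq> s A6) = ((s B4 \<noteq> s B5) \<noteq> s B6)) =
      (s B5 = (((s A1 \<noteq> s A3) \<noteq> s A5) \<noteq> (s B1 \<noteq> s B3)))"
    if "s A4 = ((s A1 \<noteq> s A2) \<noteq> s A5)" "s A6 = ((s A2 \<noteq> s A3) \<noteq> s A5)"
      "s B4 = ((s B1 \<noteq> s B2) \<noteq> s B5)" "s B6 = ((s B2 \<noteq> s B3) \<noteq> s B5)"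
    unfolding that by (simp only: parity_normalize)
  then show ?thesis unfolding Z_checks_def e by (intro conj_cong refl)
qed

text \<open>The joint eigenvalue of \<open>logical_ZA\<close> and \<open>logical_ZB\<close> on the
  basis label, with \<open>True\<close> for -1.\<close>

definition logical_label :: "(qubit \<Rightarrow> bool) \<Rightarrow> logical_qubit \<Rightarrow> bool" where
  "logical_label s =
     case_logical_qubit ((s A1 \<noteq> s A2) \<noteq> s A3) ((s B1 \<noteq> s B2) \<noteq> s B3)"

text \<open>A coset of the group generated by the supports of g1, ..., g5 is singled out by the Z parity
  checks and the two logical Z parities; its 32 elements are superposed uniformly.\<close>

definition standard_encoding :: "complex ^ (logical_qubit \<Rightarrow> bool) ^ (qubit \<Rightarrow> bool)" where
  "standard_encoding =
     (\<chi> s l. if Z_checks s \<and> logical_label s = l then 1 / complex_of_real (sqrt 32) else 0)"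

lemma standard_encoding_apply:
  "(standard_encoding *v \<phi>) $ s =
     (if Z_checks s then \<phi> $ logical_label s / complex_of_real (sqrt 32) else 0)"
  by (simp add: standard_encoding_def matrix_vector_mult_def if_distrib[of "\<lambda>x. x * _"] cong: if_cong)

text \<open>Fixing the label determines \<open>A3\<close> and \<open>B3\<close> as well, so
  \<open>A1\<close>, \<open>A2\<close>, \<open>A5\<close>, \<open>B1\<close>, \<open>B2\<close> are
  the free bits; \<open>f\<close> fills in all others.\<close>

lemma card_logical_fibre: "card {s. Z_checks s \<and> logical_label s = l} = 32"
proof -
  define f :: "bool \<times> bool \<times> bool \<times> bool \<times> bool \<Rightarrow> qubit \<Rightarrow> bool" where
    "f = (\<lambda>(a1, a2, a5, b1, b2).
      let a3 = ((a1 \<noteq> a2) \<noteq> l LA); b3 = ((b1 \<noteq> b2) \<noteq> l LB);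
          b5 = (((a1 \<noteq> a3) \<noteq> a5) \<noteq> (b1 \<noteq> b3))
      in case_qubit a1 a2 a3 ((a1 \<noteq> a2) \<noteq> a5) a5 ((a2 \<noteq> a3) \<noteq> a5)
           b1 b2 b3 ((b1 \<noteq> b2) \<noteq> b5) b5 ((b2 \<noteq> b3) \<noteq> b5))"
  define g :: "(qubit \<Rightarrow> bool) \<Rightarrow> bool \<times> bool \<times> bool \<times> bool \<times> bool" where
    "g = (\<lambda>s. (s A1, s A2, s A5, s B1, s B2))"
  have "bij_betw f UNIV {s. Z_checks s \<and> logical_label s = l}"
  proof (rule bij_betw_byWitness[where f' = g])
    show "\<forall>x\<in>UNIV. g (f x) = x" by (simp add: f_def g_def Let_def)
    show "\<forall>s\<in>{s. Z_checks s \<and> logical_label s = l}. f (g s) = s"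
    proof
      fix s assume "s \<in> {s. Z_checks s \<and> logical_label s = l}"
      then have l: "l = logical_label s" and "Z_checks s" by auto
      note z = this(2)[unfolded Z_checks_solved]
      have "f (g s) q = s q" for q
        by (cases q; simp only: z l f_def g_def Let_def logical_label_def prod.case qubit.case
            logical_qubit.case parity_normalize)
      then show "f (g s) = s" by (rule ext)
    qed
    show "f ` UNIV \<subseteq> {s. Z_checks s \<and> logical_label s = l}"
    proof
      fix s assume "s \<in> f ` UNIV"
      then obtain a1 a2 a5 b1 b2 where s: "s = f (a1, a2, a5, b1, b2)" by auto
      have "logical_label s q = l q" for q
        by (cases q; simp only: s f_def Let_def logical_label_def prod.case qubit.case
            logical_qubit.case parity_normalize)
      moreover have "Z_checks s"
        unfolding Z_checks_solved
        by (intro conjI) (simp_all only: s f_def Let_def prod.case qubit.case parity_normalize)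
      ultimately show "s \<in> {s. Z_checks s \<and> logical_label s = l}" by auto
    qed
    show "g ` {s. Z_checks s \<and> logical_label s = l} \<subseteq> UNIV" by simp
  qed
  then have "card {s. Z_checks s \<and> logical_label s = l} =
      card (UNIV :: (bool \<times> bool \<times> bool \<times> bool \<times> bool) set)"
    by (metis bij_betw_same_card)
  then show ?thesis by (simp add: card_prod)
qed

lemma norm_standard_encoding: "norm (standard_encoding *v \<phi>) = norm \<phi>"
proof -
  let ?h = "\<lambda>s. (cmod (\<phi> $ logical_label s))\<^sup>2 / 32"
  have sq: "(norm x)\<^sup>2 = (\<Sum>i\<in>UNIV. (cmod (x $ i))\<^sup>2)" for x :: "complex ^ 'n"
    by (simp add: norm_vec_def L2_set_def sum_nonneg)
  have "(norm (standard_encoding *v \<phi>))\<^sup>2 = (\<Sum>s\<in>UNIV. if Z_checks s then ?h s else 0)"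
    unfolding sq by (intro sum.cong) (simp_all add: standard_encoding_apply norm_divide power_divide)
  also have "\<dots> = (\<Sum>s | Z_checks s. ?h s)"
    by (simp add: sum.If_cases)
  \<comment> \<open>Each fibre of \<open>logical_label\<close> consists of 32 equal terms,
    cancelling the factor 1/32.\<close>
  also have "\<dots> = (\<Sum>l\<in>UNIV. \<Sum>s | s \<in> {s. Z_checks s} \<and> logical_label s = l. ?h s)"
    by (rule sum.group[symmetric]) auto
  also have "\<dots> = (\<Sum>l\<in>UNIV. (cmod (\<phi> $ l))\<^sup>2)"
    by (intro sum.cong refl) (simp add: card_logical_fibre)
  also have "\<dots> = (norm \<phi>)\<^sup>2" by (simp add: sq)
  finally show ?thesis by simp
qed

lemma case_logical_qubit_upd:
  "(case_logical_qubit a b)(LA := c) = case_logical_qubit c b"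
  "(case_logical_qubit a b)(LB := c) = case_logical_qubit a c"
  by (auto simp: fun_eq_iff split: logical_qubit.split)

text \<open>The bit \<open>c\<close> makes flips conditional, so that one composite expression can
  steer every label to its representative.\<close>

definition flip :: "qubit set \<Rightarrow> bool \<Rightarrow> (qubit \<Rightarrow> bool) \<Rightarrow> qubit \<Rightarrow> bool" where
  "flip S c s = (\<lambda>q. if q \<in> S then s q \<noteq> c else s q)"

lemma stabilizer_X_apply:
  "(g1 *v \<psi>) $ s = \<psi> $ flip {A1, A2, A4, A5} True s"
  "(g2 *v \<psi>) $ s = \<psi> $ flip {A2, A3, A5, A6} True s"
  "(g3 *v \<psi>) $ s = \<psi> $ flip {B1, B2, B4, B5} True s"
  "(g4 *v \<psi>) $ s = \<psi> $ flip {B2, B3, B5, B6} True s"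
  "(g5 *v \<psi>) $ s = \<psi> $ flip {A4, A5, A6, B4, B5, B6} True s"
  by (auto simp: stabilizer_defs mult_action X_apply flip_def fun_eq_iff
      intro!: arg_cong[where f = "vec_nth \<psi>"])

lemma if_uminus_twice:
  "(if p then - (if q then - x else x) else (if q then - x else x)) =
    (if p \<noteq> q then - x else (x :: 'a::group_add))"
  by auto

lemma stabilizer_Z_apply:
  "(g6 *v \<psi>) $ s = (if (s A1 \<noteq> s A2) = (s A4 \<noteq> s A5) then \<psi> $ s else - \<psi> $ s)"
  "(g7 *v \<psi>) $ s = (if (s A2 \<noteq> s A3) = (s A5 \<noteq> s A6) then \<psi> $ s else - \<psi> $ s)"
  "(g8 *v \<psi>) $ s = (if (s B1 \<noteq> s B2) = (s B4 \<noteq> s B5) then \<psi> $ s else - \<psi> $ s)"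
  "(g9 *v \<psi>) $ s = (if (s B2 \<noteq> s B3) = (s B5 \<noteq> s B6) then \<psi> $ s else - \<psi> $ s)"
  "(g10 *v \<psi>) $ s = (if ((s A4 \<noteq> s A5) \<noteq> s A6) = ((s B4 \<noteq> s B5) \<noteq> s B6)
    then \<psi> $ s else - \<psi> $ s)"
proof -
  have swap: "(if p then - x else x) = (if \<not> p then x else - x)" for p and x :: complex
    by auto
  have
    "(g6 *v \<psi>) $ s = (if s A1 \<noteq> (s A2 \<noteq> (s A4 \<noteq> s A5)) then - \<psi> $ s else \<psi> $ s)"
    "(g7 *v \<psi>) $ s = (if s A2 \<noteq> (s A3 \<noteq> (s A5 \<noteq> s A6)) then - \<psi> $ s else \<psi> $ s)"
    "(g8 *v \<psi>) $ s = (if s B1 \<noteq> (s B2 \<noteq> (s B4 \<noteq> s B5)) then - \<psi> $ s else \<psi> $ s)"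
    "(g9 *v \<psi>) $ s = (if s B2 \<noteq> (s B3 \<noteq> (s B5 \<noteq> s B6)) then - \<psi> $ s else \<psi> $ s)"
    "(g10 *v \<psi>) $ s = (if s A4 \<noteq> (s A5 \<noteq> (s A6 \<noteq> (s B4 \<noteq> (s B5 \<noteq> s B6))))
      then - \<psi> $ s else \<psi> $ s)"
    by (simp_all only: stabilizer_defs mult_action Z_apply if_uminus_twice)
  note signs = this[unfolded swap]
  show "(g6 *v \<psi>) $ s = (if (s A1 \<noteq> s A2) = (s A4 \<noteq> s A5) then \<psi> $ s else - \<psi> $ s)"
    "(g7 *v \<psi>) $ s = (if (s A2 \<noteq> s A3) = (s A5 \<noteq> s A6) then \<psi> $ s else - \<psi> $ s)"
    "(g8 *v \<psi>) $ s = (if (s B1 \<noteq> s B2) = (s B4 \<noteq> s B5) then \<psi> $ s else - \<psi> $ s)"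
    "(g9 *v \<psi>) $ s = (if (s B2 \<noteq> s B3) = (s B5 \<noteq> s B6) then \<psi> $ s else - \<psi> $ s)"
    "(g10 *v \<psi>) $ s = (if ((s A4 \<noteq> s A5) \<noteq> s A6) = ((s B4 \<noteq> s B5) \<noteq> s B6)
      then \<psi> $ s else - \<psi> $ s)"
    by (simp_all only: signs parity_normalize)
qed

lemma logical_apply:
  "(logical_XA *v \<psi>) $ s = \<psi> $ flip {A1, A2, A3} True s"
  "(logical_XB *v \<psi>) $ s = \<psi> $ flip {B1, B2, B3} True s"
  "(logical_ZA *v \<psi>) $ s = (if logical_label s LA then - \<psi> $ s else \<psi> $ s)"
  "(logical_ZB *v \<psi>) $ s = (if logical_label s LB then - \<psi> $ s else \<psi> $ s)"
proof -
  show "(logical_XA *v \<psi>) $ s = \<psi> $ flip {A1, A2, A3} True s"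
    "(logical_XB *v \<psi>) $ s = \<psi> $ flip {B1, B2, B3} True s"
    by (auto simp: logical_defs mult_action X_apply flip_def fun_eq_iff
        intro!: arg_cong[where f = "vec_nth \<psi>"])
  show "(logical_ZA *v \<psi>) $ s = (if logical_label s LA then - \<psi> $ s else \<psi> $ s)"
    "(logical_ZB *v \<psi>) $ s = (if logical_label s LB then - \<psi> $ s else \<psi> $ s)"
    by (simp_all only: logical_defs mult_action Z_apply if_uminus_twice logical_label_def
        logical_qubit.case parity_normalize)
qed

lemma flip_code:
  assumes "\<psi> \<in> code_space"
    and "S \<in> {{A1, A2, A4, A5}, {A2, A3, A5, A6}, {B1, B2, B4, B5}, {B2, B3, B5, B6},
              {A4, A5, A6, B4, B5, B6}}"
  shows "\<psi> $ flip S c s = \<psi> $ s"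
proof (cases c)
  case True
  have "(g *v \<psi>) $ s = \<psi> $ s" if "g \<in> {g1, g2, g3, g4, g5}" for g
    using assms(1) that by (auto simp: code_space_def)
  from this[of g1] this[of g2] this[of g3] this[of g4] this[of g5] show ?thesis
    using assms(2) True by (auto simp: stabilizer_X_apply)
qed (simp add: flip_def)

lemma standard_encoding_in_code_space: "standard_encoding *v \<phi> \<in> code_space"
proof -
  \<comment> \<open>Each X support meets every Z check and every logical Z in an even number of
    qubits.\<close>
  have "Z_checks (flip S True s) = Z_checks s \<and> logical_label (flip S True s) = logical_label s"
    if "S \<in> {{A1, A2, A4, A5}, {A2, A3, A5, A6}, {B1, B2, B4, B5}, {B2, B3, B5, B6},
             {A4, A5, A6, B4, B5, B6}}" for S s
    using that
    by (intro conjI; elim insertE emptyE; simp add: Z_checks_def logical_label_def flip_def;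
        (simp only: parity_normalize)?)
  then have "(g *v (standard_encoding *v \<phi>)) $ s = (standard_encoding *v \<phi>) $ s"
    if "g \<in> {g1, g2, g3, g4, g5}" for g s
    using that
    by (elim insertE emptyE; simp only: stabilizer_X_apply standard_encoding_apply insert_iff
        simp_thms)
  moreover have "(g *v (standard_encoding *v \<phi>)) $ s = (standard_encoding *v \<phi>) $ s"
    if "g \<in> {g6, g7, g8, g9, g10}" for g s
  proof (cases "Z_checks s")
    case True
    then show ?thesis
      using that unfolding Z_checks_def
      by (elim insertE emptyE conjE) (simp_all only: stabilizer_Z_apply if_True refl)
  next
    case False
    then show ?thesis
      using that by (elim insertE emptyE) (simp_all add: stabilizer_Z_apply standard_encoding_apply)
  qed
  ultimately have "g *v (standard_encoding *v \<phi>) = standard_encoding *v \<phi>"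
    if "g \<in> {g1, g2, g3, g4, g5} \<union> {g6, g7, g8, g9, g10}" for g
    using that unfolding vec_eq_iff by blast
  then show ?thesis by (simp add: code_space_def)
qed

text \<open>Three copies of a bit have that bit as parity, so this label lies in the coset of
  \<open>l\<close>.\<close>

definition logical_representative :: "(logical_qubit \<Rightarrow> bool) \<Rightarrow> qubit \<Rightarrow> bool" where
  "logical_representative l =
     case_qubit (l LA) (l LA) (l LA) False False False (l LB) (l LB) (l LB) False False False"

lemma code_representative:
  assumes "\<psi> \<in> code_space" "Z_checks s"
  shows "\<psi> $ s = \<psi> $ logical_representative (logical_label s)"
proof -
  \<comment> \<open>The first four flips set qubits 1, 2, 3 of each block to their common parity;
    the flip by the support of \<open>g5\<close> then clears qubits 4, 5, 6, by the checks.\<close>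
  let ?t = "flip {A1, A2, A4, A5} (s A2 \<noteq> s A3) (flip {A2, A3, A5, A6} (s A1 \<noteq> s A2)
    (flip {B1, B2, B4, B5} (s B2 \<noteq> s B3) (flip {B2, B3, B5, B6} (s B1 \<noteq> s B2)
    (flip {A4, A5, A6, B4, B5, B6} ((s A1 \<noteq> s A3) \<noteq> s A5) s))))"
  note z = assms(2)[unfolded Z_checks_solved]
  have "logical_representative (logical_label s) q = ?t q" for q
    by (cases q; simp add: z logical_representative_def logical_label_def flip_def;
        (simp only: parity_normalize)?)
  then have "logical_representative (logical_label s) = ?t" by (rule ext)
  then show ?thesis by (simp add: flip_code[OF assms(1)])
qed

text \<open>A violated check would force \<open>\<psi> $ s = - \<psi> $ s\<close>.\<close>

lemma code_zero:
  assumes "\<psi> \<in> code_space" "\<not> Z_checks s"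
  shows "\<psi> $ s = 0"
proof (rule ccontr)
  assume "\<psi> $ s \<noteq> 0"
  then have sign: "(if p then \<psi> $ s else - \<psi> $ s) = \<psi> $ s \<longleftrightarrow> p" for p
    by simp
  have "(g6 *v \<psi>) $ s = \<psi> $ s" "(g7 *v \<psi>) $ s = \<psi> $ s" "(g8 *v \<psi>) $ s = \<psi> $ s"
    "(g9 *v \<psi>) $ s = \<psi> $ s" "(g10 *v \<psi>) $ s = \<psi> $ s"
    using assms(1) by (simp_all add: code_space_def)
  then have "Z_checks s"
    unfolding stabilizer_Z_apply sign Z_checks_def by (intro conjI)
  with assms(2) show False by contradiction
qed

lemma standard_encoding_surj:
  assumes "\<psi> \<in> code_space"
  shows "standard_encoding *v (\<chi> l. complex_of_real (sqrt 32) * \<psi> $ logical_representative l) = \<psi>"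
  using code_representative[OF assms] code_zero[OF assms]
  by (simp add: vec_eq_iff standard_encoding_apply)

text \<open>Ensures that a statement about all encodings is not vacuous.\<close>

lemma is_encoding_standard: "is_encoding standard_encoding"
proof -
  have "range ((*v) standard_encoding) = code_space"
    using standard_encoding_in_code_space standard_encoding_surj
    by (auto simp: image_iff) metis
  moreover have "Z_checks (flip S True s) = Z_checks s"
    if "S \<in> {{A1, A2, A3}, {B1, B2, B3}}" for S s
    using that
    by (elim insertE emptyE; simp add: Z_checks_def flip_def; (simp only: parity_normalize)?)
  \<comment> \<open>A logical X meets its own logical Z in three qubits and the other one in none,
    so exactly one bit of the label changes.\<close>
  moreover have
    "logical_label (flip {A1, A2, A3} True s) = (logical_label s)(LA := \<not> logical_label s LA)"
    "logical_label (flip {B1, B2, B3} True s) = (logical_label s)(LB := \<not> logical_label s LB)"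
    for s
    by (simp_all add: logical_label_def flip_def case_logical_qubit_upd)
  ultimately show ?thesis
    by (simp add: is_encoding_def norm_standard_encoding matrix_eq vec_eq_iff mult_action
        standard_encoding_apply logical_apply X_apply Z_apply)
qed

section \<open>Uniqueness of the logical Hadamard up to a phase\<close>

lemma axis_eq_X_products:
  fixes l :: "logical_qubit \<Rightarrow> bool"
  defines "e \<equiv> axis (\<lambda>_. False) 1 :: complex ^ (logical_qubit \<Rightarrow> bool)"
  shows "axis l 1 \<in> {e, X LA *v e, X LB *v e, X LA *v (X LB *v e)}"
proof -
  have "X j *v axis k 1 = axis (k(j := \<not> k j)) (1 :: complex)" for j and k :: "logical_qubit \<Rightarrow> bool"
  proof -
    have "s(j := \<not> s j) = k \<longleftrightarrow> s = k(j := \<not> k j)" for s :: "logical_qubit \<Rightarrow> bool" by auto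
    then show ?thesis by (simp add: vec_eq_iff X_apply axis_def)
  qed
  moreover have "l = case_logical_qubit (l LA) (l LB)"
    by (auto simp: fun_eq_iff split: logical_qubit.split)
  moreover have "(\<lambda>_. False) = case_logical_qubit False False"
    by (auto simp: fun_eq_iff split: logical_qubit.split)
  ultimately show ?thesis
    by (cases "l LA"; cases "l LB") (auto simp: e_def case_logical_qubit_upd)
qed

lemma matrix_eq_on_axis:
  fixes A B :: "complex ^ 'n ^ 'm"
  assumes "\<And>l. A *v axis l 1 = B *v axis l 1"
  shows "A = B"
  proof -
  have "A $ i $ l = B $ i $ l" for i l
    using arg_cong[OF assms[of l], of "\<lambda>v. v $ i"]
    by (simp add: matrix_vector_mult_def axis_def if_distrib[of "\<lambda>x. _ * x"] cong: if_cong)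
  then show ?thesis by (simp add: vec_eq_iff)
qed

text \<open>A form of Schur's lemma: linear maps into the code space that intertwine the abstract
  Paulis with the logical ones are multiples of \<open>V\<close>.\<close>

lemma encoding_code_hadamard:
  assumes "is_encoding V"
  shows "\<exists>c::complex. cmod c = 1 \<and> (\<forall>\<phi>. code_hadamard (V *v \<phi>) = c *s (V *v (H LA *v \<phi>)))"
proof -
  have nV: "norm (V *v \<phi>) = norm \<phi>" for \<phi> using assms by (simp add: is_encoding_def)
  have rV: "range ((*v) V) = code_space" using assms by (simp add: is_encoding_def)
  have V_action:
    "V *v (X LA *v \<phi>) = logical_XA *v (V *v \<phi>)" "V *v (Z LA *v \<phi>) = logical_ZA *v (V *v \<phi>)"
    "V *v (X LB *v \<phi>) = logical_XB *v (V *v \<phi>)" "V *v (Z LB *v \<phi>) = logical_ZB *v (V *v \<phi>)" for \<phi>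
    using assms by (simp_all add: is_encoding_def matrix_vector_mul_assoc)
  have injV: "x = y" if "V *v x = V *v y" for x y
    using nV[of "x - y"] that by (simp add: matrix_vector_mult_diff_distrib)
  \<comment> \<open>The factor \<open>H LA\<close> undoes the exchange of X and Z by
    \<open>code_hadamard\<close>, so \<open>M\<close> intertwines the Paulis exactly as
    \<open>V\<close> does.\<close>
  define M where "M = ((1 / sqrt 2) *\<^sub>R (HA ** (X456A + Z456A))) ** V ** H LA"
  have M: "M *v \<phi> = code_hadamard (V *v (H LA *v \<phi>))" for \<phi>
    by (simp add: M_def code_hadamard_def mult_action scaleR_matrix_vector_mult
        matrix_vector_mult_add_rdistrib)
  have M_action:
    "M *v (X LA *v \<phi>) = logical_XA *v (M *v \<phi>)" "M *v (Z LA *v \<phi>) = logical_ZA *v (M *v \<phi>)"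
    "M *v (X LB *v \<phi>) = logical_XB *v (M *v \<phi>)" "M *v (Z LB *v \<phi>) = logical_ZB *v (M *v \<phi>)" for \<phi>
    by (simp_all add: M H_X H_Z on_qubit_commute[of LA LB] V_action code_hadamard_logical)
  \<comment> \<open>A vector fixed by both logical Paulis Z is a multiple of the all-zero basis vector; the
     logical Paulis X carry this to the whole basis.\<close>
  let ?e = "axis (\<lambda>_. False) 1 :: complex ^ (logical_qubit \<Rightarrow> bool)"
  have "M *v ?e \<in> range ((*v) V)"
    unfolding rV M by (rule code_hadamard_in_code_space) (use rV in auto)
  then obtain \<xi> where \<xi>: "M *v ?e = V *v \<xi>" by auto
  have e: "Z j *v ?e = ?e" for j by (auto simp: vec_eq_iff Z_apply axis_def)
  have "Z LA *v \<xi> = \<xi>" "Z LB *v \<xi> = \<xi>"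
    by (rule injV, metis M_action(2,4) V_action(2,4) \<xi> e)+
  then have fixed: "Z j *v \<xi> = \<xi>" for j by (cases j) auto
  define c where "c = \<xi> $ (\<lambda>_. False)"
  have "\<xi> $ k = 0" if "k \<noteq> (\<lambda>_. False)" for k
  proof -
    \<comment> \<open>At a label with bit \<open>j\<close> set, \<open>fixed\<close> gives
      \<open>\<xi> $ k = - \<xi> $ k\<close>.\<close>
    from that obtain j where "k j" by auto
    then show ?thesis using fixed[of j] Z_apply[of j \<xi> k] by simp
  qed
  then have \<xi>_eq: "\<xi> = axis (\<lambda>_. False) c" by (auto simp: vec_eq_iff axis_def c_def)
  have norm_axis: "norm (axis k x) = norm x" for k :: "logical_qubit \<Rightarrow> bool" and x :: complex
    by (simp add: norm_eq_sqrt_inner inner_axis_axis)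
  have "norm (M *v ?e) = 1"
    unfolding M by (rule norm_code_hadamard) (use rV in \<open>auto simp: nV norm_axis\<close>)
  then have "cmod c = 1" by (simp add: \<xi> nV \<xi>_eq norm_axis)
  define N where "N = (\<chi> i j. c * V $ i $ j)"
  have N: "N *v \<phi> = c *s (V *v \<phi>)" for \<phi>
    by (simp add: N_def vec_eq_iff matrix_vector_mult_def sum_distrib_left mult.assoc)
  have scale: "A *v (c *s v) = c *s (A *v v)" for A :: "qubit operator" and v
    by (simp add: vec_eq_iff matrix_vector_mult_def sum_distrib_left mult.left_commute)
  have Me: "M *v ?e = N *v ?e"
  proof -
    have "V *v axis (\<lambda>_. False) c = c *s (V *v ?e)"
      by (simp add: vec_eq_iff matrix_vector_mult_def sum_distrib_left axis_def
          if_distrib[of "\<lambda>x. _ * x"] cong: if_cong)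
    then show ?thesis by (simp add: N \<xi> \<xi>_eq)
  qed
  have "M = N"
  proof (rule matrix_eq_on_axis)
    fix l
    show "M *v axis l 1 = N *v axis l 1"
      using axis_eq_X_products[of l] Me by (auto simp: M_action N V_action scale)
  qed
  then have "code_hadamard (V *v \<phi>) = c *s (V *v (H LA *v \<phi>))" for \<phi>
    using M[of "H LA *v \<phi>"] by (simp add: H_H N)
  with \<open>cmod c = 1\<close> show ?thesis by blast
qed

theorem mainTheorem2:
  shows
    "(\<forall>\<psi> \<in> code_space. norm \<psi> = 1 \<longrightarrow>
        syndrome_prob 1 1 (HA *v \<psi>) = 0 \<and> syndrome_prob (-1) (-1) (HA *v \<psi>) = 0) \<and>
     (\<forall>(a, b) \<in> {(1, -1), (-1, 1)}. \<forall>\<psi> \<in> code_space. norm \<psi> = 1 \<longrightarrow>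
        protocol a b \<psi> \<in> code_space \<and>
        protocol a b (logical_XA *v \<psi>) = logical_ZA *v protocol a b \<psi> \<and>
        protocol a b (logical_ZA *v \<psi>) = logical_XA *v protocol a b \<psi> \<and>
        protocol a b (logical_XB *v \<psi>) = logical_XB *v protocol a b \<psi> \<and>
        protocol a b (logical_ZB *v \<psi>) = logical_ZB *v protocol a b \<psi>) \<and>
     (\<exists>V. is_encoding V) \<and>
     (\<forall>V. is_encoding V \<longrightarrow>
        (\<exists>c::complex. cmod c = 1 \<and>
          (\<forall>(a, b) \<in> {(1, -1), (-1, 1)}. \<forall>\<phi>. norm \<phi> = 1 \<longrightarrow>
              protocol a b (V *v \<phi>) = c *s (V *v (H LA *v \<phi>)))))"
proof (intro conjI)
  show "\<forall>\<psi> \<in> code_space. norm \<psi> = 1 \<longrightarrow>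
      syndrome_prob 1 1 (HA *v \<psi>) = 0 \<and> syndrome_prob (-1) (-1) (HA *v \<psi>) = 0"
    by (simp add: syndrome_prob_def syndrome_proj_HA)
  have "protocol a b \<psi> \<in> code_space \<and>
      protocol a b (logical_XA *v \<psi>) = logical_ZA *v protocol a b \<psi> \<and>
      protocol a b (logical_ZA *v \<psi>) = logical_XA *v protocol a b \<psi> \<and>
      protocol a b (logical_XB *v \<psi>) = logical_XB *v protocol a b \<psi> \<and>
      protocol a b (logical_ZB *v \<psi>) = logical_ZB *v protocol a b \<psi>"
    if "(a, b) \<in> {(1, -1), (-1, 1)}" "\<psi> \<in> code_space" "norm \<psi> = 1" for a b \<psi>
    \<comment> \<open>Logical operators preserve the code space and the norm, so the closed form
      applies to both sides of each equation.\<close>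
    by (simp add: protocol_eq_code_hadamard[OF _ _ that(1)] that(2,3) logical_in_code_space
        norm_logical code_hadamard_logical code_hadamard_in_code_space)
  then show "\<forall>(a, b) \<in> {(1, -1), (-1, 1)}. \<forall>\<psi> \<in> code_space. norm \<psi> = 1 \<longrightarrow>
      protocol a b \<psi> \<in> code_space \<and>
      protocol a b (logical_XA *v \<psi>) = logical_ZA *v protocol a b \<psi> \<and>
      protocol a b (logical_ZA *v \<psi>) = logical_XA *v protocol a b \<psi> \<and>
      protocol a b (logical_XB *v \<psi>) = logical_XB *v protocol a b \<psi> \<and>
      protocol a b (logical_ZB *v \<psi>) = logical_ZB *v protocol a b \<psi>"
    by blast
  show "\<exists>V. is_encoding V" using is_encoding_standard by blast
  show "\<forall>V. is_encoding V \<longrightarrow>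
      (\<exists>c::complex. cmod c = 1 \<and>
        (\<forall>(a, b) \<in> {(1, -1), (-1, 1)}. \<forall>\<phi>. norm \<phi> = 1 \<longrightarrow>
            protocol a b (V *v \<phi>) = c *s (V *v (H LA *v \<phi>))))"
  proof (intro allI impI)
    fix V assume V: "is_encoding V"
    \<comment> \<open>One phase serves both outcomes, since \<open>code_hadamard\<close> does not
      depend on them.\<close>
    obtain c where c: "cmod c = 1" "\<And>\<phi>. code_hadamard (V *v \<phi>) = c *s (V *v (H LA *v \<phi>))"
      using encoding_code_hadamard[OF V] by blast
    have "protocol a b (V *v \<phi>) = c *s (V *v (H LA *v \<phi>))"
      if "(a, b) \<in> {(1, -1), (-1, 1)}" "norm \<phi> = 1" for a b \<phi>
    proof -
      have "V *v \<phi> \<in> code_space" "norm (V *v \<phi>) = 1"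
        using V that(2) by (auto simp: is_encoding_def)
      then show ?thesis using protocol_eq_code_hadamard[OF _ _ that(1)] c(2) by simp
    qed
    then show "\<exists>c::complex. cmod c = 1 \<and>
        (\<forall>(a, b) \<in> {(1, -1), (-1, 1)}. \<forall>\<phi>. norm \<phi> = 1 \<longrightarrow>
            protocol a b (V *v \<phi>) = c *s (V *v (H LA *v \<phi>)))"
      using c(1) by blast
  qed
qed

end
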